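(* Let $\|\cdot\|$ be a norm on $\mathbb{R}^m$ with dual norm $\|\cdot\|_*$, $\Xi=\mathbb{R}^m$, $\widehat\xi_1,\dots,\widehat\xi_N\in\mathbb{R}^m$, $\widehat{\mathbb P}_N=\frac1N\sum_{i=1}^N\delta_{\widehat\xi_i}$, $\varepsilon\ge0$, $\alpha\in[0,1)$, $\mathbb X\subseteq\mathbb{R}^m$, and let $f:\mathbb{R}\to\mathbb{R}$ be a Lipschitz continuous convex function with (smallest) Lipschitz constant ${\rm Lip}(f)$. In the case $\ell(\xi)=f(x^\top\xi)$, the CVaR-Wasserstein distributionally robust problem $$\min_{x\in\mathbb X}\ \sup_{\mathbb P\in\mathbb{B}^{\alpha}_{(1),\varepsilon}(\widehat{\mathbb P}_N)}\mathbb{E}^{\mathbb P}[f(x^\top\xi)]$$ can be solved by (i.e. is equivalent to) $$\min_{x\in\mathbb X}\max\left\{\frac1N\sum_{i=1}^N f(x^\top\widehat\xi_i)+{\rm Lip}(f)\|x\|_*(1-\alpha)\varepsilon,\ \frac1N\sum_{i=1}^N\max\big\{f_1(x^\top\widehat\xi_i-\varepsilon\|x\|_* ),\ f_2(x^\top\widehat\xi_i+\varepsilon\|x\|_* )\big\}\right\},$$ where $f_1(t)=f(t)1_{\{t<t_0\}}+f(t_0)1_{\{t\ge t_0\}}$, $f_2(t)=f(t_0)1_{\{t\le t_0\}}+f(t)1_{\{t>t_0\}}$, and $t_0\in[-\infty,\infty]$ is such that $f$ is decreasing on $(-\infty,t_0)$ and increasing on $(t_0,\infty)$.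
   Context: ${\rm CVaR}_\alpha(X)=\frac1{1-\alpha}\int_\alpha^1{\rm VaR}_u(X)\,du$ with ${\rm VaR}_u(X)=\inf\{x:\mathbb{P}(X\le x)\ge u\}$. $d_{{\rm CVaR}_\alpha}(\mathbb P_1,\mathbb P_2)=\inf_\Pi{\rm CVaR}_\alpha^\Pi(\|\xi_1-\xi_2\|)$, infimum over joint distributions $\Pi$ of $(\xi_1,\xi_2)$ with marginals $\mathbb P_1,\mathbb P_2$; $\mathbb{B}^{\alpha}_{(1),\varepsilon}(\widehat{\mathbb P}_N)$ is the set of probability distributions $\mathbb P$ on $\Xi$ with $d_{{\rm CVaR}_\alpha}(\widehat{\mathbb P}_N,\mathbb P)\le\varepsilon$. If $t_0=\pm\infty$, $f(t_0)$ is understood as the corresponding limit of $f$ (possibly $-\infty$). Equivalence means that for each $x\in\mathbb X$ the inner supremum equals the outer maximum in the second problem. *)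

theory Defs
  imports "HOL-Probability.Probability"
begin

definition is_norm :: "('a::real_vector \<Rightarrow> real) \<Rightarrow> bool" where
  "is_norm nrm \<longleftrightarrow>
     (\<forall>v. 0 \<le> nrm v) \<and> (\<forall>v. nrm v = 0 \<longleftrightarrow> v = 0) \<and>
     (\<forall>c v. nrm (c *\<^sub>R v) = \<bar>c\<bar> * nrm v) \<and> (\<forall>v w. nrm (v + w) \<le> nrm v + nrm w)"

definition dual_norm :: "('a::real_inner \<Rightarrow> real) \<Rightarrow> 'a \<Rightarrow> real" where
  "dual_norm nrm x = (SUP v\<in>{v. nrm v \<le> 1}. x \<bullet> v)"

definition Lip :: "(real \<Rightarrow> real) \<Rightarrow> real" where
  "Lip f = Inf {L. L-lipschitz_on UNIV f}"

text \<open>Extended-valued integral, positive part minus negative part. Unlike the Bochner integral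
  it does not default to 0 on non-integrable functions; in particular it can be infinite.\<close>

definition ereal_integral :: "'a measure \<Rightarrow> ('a \<Rightarrow> ereal) \<Rightarrow> ereal" where
  "ereal_integral M g =
     enn2ereal (\<integral>\<^sup>+ \<omega>. e2ennreal (g \<omega>) \<partial>M) - enn2ereal (\<integral>\<^sup>+ \<omega>. e2ennreal (- g \<omega>) \<partial>M)"

definition VaR :: "real \<Rightarrow> 'a measure \<Rightarrow> ('a \<Rightarrow> real) \<Rightarrow> ereal" where
  "VaR u M X = Inf {ereal x | x. measure M {\<omega> \<in> space M. X \<omega> \<le> x} \<ge> u}"

definition CVaR :: "real \<Rightarrow> 'a measure \<Rightarrow> ('a \<Rightarrow> real) \<Rightarrow> ereal" where
  "CVaR \<alpha> M X =
     ereal (1 / (1 - \<alpha>)) * ereal_integral (restrict_space lborel {\<alpha>..1}) (\<lambda>u. VaR u M X)"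

definition couplings ::
    "'a::euclidean_space measure \<Rightarrow> 'a measure \<Rightarrow> ('a \<times> 'a) measure set" where
  "couplings P1 P2 =
     {Q. prob_space Q \<and> sets Q = sets (borel \<Otimes>\<^sub>M borel) \<and>
         distr Q borel fst = P1 \<and> distr Q borel snd = P2}"

definition d_CVaR ::
    "('a::euclidean_space \<Rightarrow> real) \<Rightarrow> real \<Rightarrow> 'a measure \<Rightarrow> 'a measure \<Rightarrow> ereal" where
  "d_CVaR nrm \<alpha> P1 P2 =
     (INF Q\<in>couplings P1 P2. CVaR \<alpha> Q (\<lambda>(\<xi>1, \<xi>2). nrm (\<xi>1 - \<xi>2)))"

definition CVaR_ball ::
    "('a::euclidean_space \<Rightarrow> real) \<Rightarrow> real \<Rightarrow> real \<Rightarrow> 'a measure \<Rightarrow> 'a measure set" where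
  "CVaR_ball nrm \<alpha> \<epsilon> Phat =
     {P. prob_space P \<and> sets P = sets borel \<and> d_CVaR nrm \<alpha> Phat P \<le> ereal \<epsilon>}"

text \<open>The library has no addition of measures, so the average of the Dirac measures at
  the sample points is written as the image of the uniform distribution on the indices.\<close>

definition empirical :: "nat \<Rightarrow> (nat \<Rightarrow> 'a::euclidean_space) \<Rightarrow> 'a measure" where
  "empirical N \<xi>s = distr (uniform_count_measure {1..N}) borel \<xi>s"

lemma measure_empirical:
  assumes "A \<in> sets borel"
  shows "measure (empirical N \<xi>s) A = (1 / real N) * (\<Sum>i=1..N. measure (return borel (\<xi>s i)) A)"
proof -
  have "measure (empirical N \<xi>s) A =
      measure (uniform_count_measure {1..N}) (\<xi>s -` A \<inter> {1..N})"
    unfolding empirical_def using assms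
    by (subst measure_distr) (auto simp: measurable_def space_uniform_count_measure
        sets_uniform_count_measure)
  also have "\<dots> = real (card (\<xi>s -` A \<inter> {1..N})) / real N"
    by (subst measure_uniform_count_measure) auto
  also have "real (card (\<xi>s -` A \<inter> {1..N})) = (\<Sum>i=1..N. indicator A (\<xi>s i))"
    by (simp add: indicator_def Int_def conj_commute flip: sum.inter_filter)
  finally show ?thesis
    using assms by (simp add: measure_return)
qed

text \<open>Value of \<open>f\<close> at an extended real point, as a limit at the infinite points.\<close>

definition at_ereal :: "(real \<Rightarrow> real) \<Rightarrow> ereal \<Rightarrow> ereal" where
  "at_ereal f s =
     (if s = \<infinity> then Lim at_top (\<lambda>t. ereal (f t))
      else if s = -\<infinity> then Lim at_bot (\<lambda>t. ereal (f t))
      else ereal (f (real_of_ereal s)))"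

definition f1 :: "(real \<Rightarrow> real) \<Rightarrow> ereal \<Rightarrow> real \<Rightarrow> ereal" where
  "f1 f t0 t = (if ereal t < t0 then ereal (f t) else at_ereal f t0)"

definition f2 :: "(real \<Rightarrow> real) \<Rightarrow> ereal \<Rightarrow> real \<Rightarrow> ereal" where
  "f2 f t0 t = (if ereal t \<le> t0 then at_ereal f t0 else ereal (f t))"

end

theory Submission
  imports Defs
begin

text \<open>
  Fix \<open>x\<close>, write \<open>c\<close> for its dual norm, and let \<open>Z\<close> be the cost \<open>nrm (\<xi>1 - \<xi>2)\<close> under a transport plan
  from the empirical distribution. Moving by \<open>Z\<close> changes \<open>x \<bullet> \<xi>\<close> by at most \<open>c * Z\<close>, and by exactly this
  much in the worst direction (\<open>dual_norm_attained\<close>), so the problem is about displacements on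
  the line. A bound on the CVaR of \<open>Z\<close> permits two extreme strategies, and the theorem says that one of them
  is always optimal, the second in the limit: every atom moves by \<open>\<epsilon>\<close>, or a vanishing fraction of
  the mass moves very far with mean cost \<open>(1 - \<alpha>) * \<epsilon>\<close> and so collects the asymptotic slope
  of \<open>f\<close>, which in the better of the two directions is \<open>Lip f\<close>.

  That no other plan does better rests on the threshold description of CVaR (\<open>CVaR_threshold\<close>): if the
  CVaR is at most \<open>e\<close>, then for some \<open>\<tau> \<in> {0..e}\<close> the mean excess of \<open>Z\<close> over \<open>\<tau>\<close> is at most
  \<open>(1 - \<alpha>) * (e - \<tau>)\<close>. Displacements up to \<open>c * \<tau>\<close> are controlled by convexity and the excess
  by the Lipschitz constant. The resulting bound is convex in \<open>\<tau>\<close>, so it is largest at \<open>\<tau> = 0\<close> or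
  \<open>\<tau> = e\<close>, and these two values correspond to the two strategies (\<open>coupling_upper_bound\<close>). Finally \<open>e\<close>
  decreases to \<open>\<epsilon>\<close>.

  Conversely both strategies lie in the ball. The first is \<open>CVaR_ball_translation\<close>. The second is
  \<open>CVaR_ball_escaping_mass\<close>, where \<open>f\<close> is bounded below by a supporting line whose slope is
  almost \<open>Lip f\<close> in absolute value (\<open>supporting_line_near_Lip\<close>). The functions
  \<open>f1\<close> and \<open>f2\<close> enter only through their maximum, which equals that of \<open>f\<close> at the two end points
  (\<open>max_f1_f2\<close>).
\<close>

section \<open>Norms and their duals\<close>

lemma is_normD:
  assumes "is_norm nrm"
  shows is_norm_nonneg: "0 \<le> nrm v"
    and is_norm_eq_0: "nrm v = 0 \<longleftrightarrow> v = 0"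
    and is_norm_scaleR: "nrm (r *\<^sub>R v) = \<bar>r\<bar> * nrm v"
    and is_norm_triangle: "nrm (v + w) \<le> nrm v + nrm w"
  using assms unfolding is_norm_def by blast+

lemma is_norm_zero: "is_norm nrm \<Longrightarrow> nrm 0 = 0"
  by (simp add: is_norm_eq_0)

lemma is_norm_convex_on:
  assumes "is_norm nrm"
  shows "convex_on UNIV nrm"
proof (rule convex_onI)
  fix t :: real and x y :: 'a
  assume "0 < t" "t < 1"
  have "nrm ((1 - t) *\<^sub>R x + t *\<^sub>R y) \<le> nrm ((1 - t) *\<^sub>R x) + nrm (t *\<^sub>R y)"
    by (rule is_norm_triangle[OF assms])
  also have "\<dots> = (1 - t) * nrm x + t * nrm y"
    using assms \<open>0 < t\<close> \<open>t < 1\<close> by (simp add: is_norm_zero is_norm_scaleR)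
  finally show "nrm ((1 - t) *\<^sub>R x + t *\<^sub>R y) \<le> (1 - t) * nrm x + t * nrm y" .
qed simp

lemma is_norm_continuous:
  fixes nrm :: "'a::euclidean_space \<Rightarrow> real"
  assumes "is_norm nrm"
  shows "continuous_on UNIV nrm"
  using convex_on_continuous[OF open_UNIV is_norm_convex_on[OF assms]] .

lemma is_norm_dominates_norm:
  fixes nrm :: "'a::euclidean_space \<Rightarrow> real"
  assumes nrm: "is_norm nrm"
  shows "\<exists>k>0. \<forall>v. k * norm v \<le> nrm v"
proof -
  have "\<exists>u\<in>sphere 0 1. \<forall>v\<in>sphere (0::'a) 1. nrm u \<le> nrm v"
    by (intro continuous_attains_inf continuous_on_subset[OF is_norm_continuous[OF nrm]]) auto
  then obtain u where u: "norm u = 1" "\<And>v. norm v = 1 \<Longrightarrow> nrm u \<le> nrm v"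
    by auto
  have "nrm u \<noteq> 0" "0 \<le> nrm u"
    using nrm u(1) by (auto simp: is_norm_eq_0 is_norm_nonneg)
  moreover have "nrm u * norm v \<le> nrm v" for v
  proof (cases "v = 0")
    case True
    then show ?thesis using nrm by (simp add: is_norm_zero is_norm_scaleR)
  next
    case False
    have "nrm u \<le> nrm ((1 / norm v) *\<^sub>R v)"
      using False by (intro u(2)) simp
    also have "\<dots> = nrm v / norm v"
      using nrm by (simp add: is_norm_zero is_norm_scaleR)
    finally show ?thesis
      using False by (simp add: field_simps)
  qed
  ultimately show ?thesis
    by (intro exI[of _ "nrm u"]) auto
qed

text \<open>The unit ball is compact, because \<open>nrm\<close> is continuous and dominates a multiple of the
  Euclidean norm. Attainment gives the worst-case perturbation direction exactly.\<close>

lemma dual_norm_attained: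
  fixes nrm :: "'a::euclidean_space \<Rightarrow> real"
  assumes nrm: "is_norm nrm"
  obtains v where "nrm v \<le> 1" "x \<bullet> v = dual_norm nrm x" 
    "\<And>w. nrm w \<le> 1 \<Longrightarrow> x \<bullet> w \<le> dual_norm nrm x"
proof -
  let ?B = "{v. nrm v \<le> 1}"
  obtain k where k: "0 < k" "\<And>v. k * norm v \<le> nrm v"
    using is_norm_dominates_norm[OF nrm] by blast
  have "norm v \<le> 1 / k" if "nrm v \<le> 1" for v
    using k(2)[of v] k(1) that by (simp add: field_simps)
  then have "bounded ?B"
    unfolding bounded_iff by blast
  moreover have "closed ?B"
    by (intro closed_Collect_le is_norm_continuous[OF nrm] continuous_on_const)
  ultimately have "compact ?B"
    by (simp add: compact_eq_bounded_closed)
  moreover have "0 \<in> ?B"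
    using nrm by (simp add: is_norm_zero is_norm_scaleR)
  ultimately obtain v where v: "v \<in> ?B" "\<And>w. w \<in> ?B \<Longrightarrow> x \<bullet> w \<le> x \<bullet> v"
    using continuous_attains_sup[of ?B "\<lambda>v. x \<bullet> v"] continuous_on_inner[OF continuous_on_const continuous_on_id]
    by (metis (no_types, lifting) empty_iff id_apply)
  then have "dual_norm nrm x = x \<bullet> v"
    unfolding dual_norm_def by (intro cSup_eq_maximum) auto
  then show ?thesis
    using v by (intro that[of v]) auto
qed

lemma dual_norm_nonneg:
  fixes nrm :: "'a::euclidean_space \<Rightarrow> real"
  assumes nrm: "is_norm nrm"
  shows "0 \<le> dual_norm nrm x"
proof -
  have "nrm 0 \<le> 1"
    using nrm by (simp add: is_norm_zero is_norm_scaleR)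
  then show ?thesis
    using dual_norm_attained[OF nrm, of x] by (metis inner_zero_right)
qed

lemma inner_le_dual_norm:
  fixes nrm :: "'a::euclidean_space \<Rightarrow> real"
  assumes nrm: "is_norm nrm"
  shows "\<bar>x \<bullet> v\<bar> \<le> dual_norm nrm x * nrm v"
proof -
  have le: "x \<bullet> w \<le> dual_norm nrm x * nrm w" for w
  proof (cases "w = 0")
    case True
    then show ?thesis using nrm by (simp add: is_norm_zero is_norm_scaleR)
  next
    case False
    then have pos: "0 < nrm w"
      using nrm by (metis is_norm_nonneg is_norm_eq_0 less_eq_real_def)
    then have "nrm ((1 / nrm w) *\<^sub>R w) \<le> 1"
      using nrm by (simp add: is_norm_zero is_norm_scaleR)
    then have "x \<bullet> ((1 / nrm w) *\<^sub>R w) \<le> dual_norm nrm x"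
      using dual_norm_attained[OF nrm, of x] by metis
    then show ?thesis
      using pos by (simp add: field_simps)
  qed
  have "nrm (- v) = nrm v"
  proof -
    have "nrm ((- 1) *\<^sub>R v) = \<bar>- 1\<bar> * nrm v"
      using nrm unfolding is_norm_def by blast
    then show ?thesis by simp
  qed
  then show ?thesis
    using le[of v] le[of "- v"] by (auto simp: abs_le_iff)
qed

section \<open>Convex Lipschitz functions on the line\<close>

lemma lipschitz_on_Lip:
  assumes "\<exists>L. L-lipschitz_on UNIV f"
  shows "(Lip f)-lipschitz_on UNIV f"
proof (rule lipschitz_onI)
  let ?S = "{L. L-lipschitz_on UNIV f}"
  have ne: "?S \<noteq> {}" using assms by auto
  show "0 \<le> Lip f"
    unfolding Lip_def by (intro cInf_greatest[OF ne]) (auto dest: lipschitz_on_nonneg)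
  fix x y :: real
  show "dist (f x) (f y) \<le> Lip f * dist x y"
  proof (cases "x = y")
    case False
    have "dist (f x) (f y) / dist x y \<le> Lip f"
      unfolding Lip_def
    proof (intro cInf_greatest[OF ne])
      fix L assume "L \<in> ?S"
      then show "dist (f x) (f y) / dist x y \<le> L"
        using False by (auto simp: divide_le_eq dest: lipschitz_onD)
    qed
    then show ?thesis
      using False by (simp add: divide_le_eq)
  qed simp
qed

lemma Lip_le:
  assumes "L-lipschitz_on UNIV f"
  shows "Lip f \<le> L"
  unfolding Lip_def using assms
  by (intro cInf_lower bdd_belowI[of _ 0]) (auto dest: lipschitz_on_nonneg)

lemma supporting_line:
  assumes "convex_on UNIV (f :: real \<Rightarrow> real)"
  obtains m where "\<And>y. f x + m * (y - x) \<le> f y"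
  using convex_le_Inf_differential[OF assms, of x] by auto

text \<open>For a convex function every difference quotient is bounded by a slope of a supporting line:
  a steep increase over \<open>[a, b]\<close> forces the line supporting at \<open>b\<close> to be at least as steep, a steep
  decrease the one supporting at \<open>a\<close>. Hence the Lipschitz constant is the supremum of the absolute
  slopes of supporting lines, and such a line bounds \<open>f\<close> from below arbitrarily far out.\<close>

lemma supporting_line_near_Lip:
  assumes conv: "convex_on UNIV f" and "\<eta> > 0"
  obtains m q where "\<And>t. q + m * t \<le> f t" "Lip f - \<eta> \<le> \<bar>m\<bar>"
proof -
  have "\<exists>m x. (\<forall>y. f x + m * (y - x) \<le> f y) \<and> Lip f - \<eta> \<le> \<bar>m\<bar>"
  proof (cases "Lip f - \<eta> < 0")
    case True
    then show ?thesis
      using supporting_line[OF conv, of 0] by (metis abs_ge_zero less_imp_le order_trans)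
  next
    case False
    have "\<not> (Lip f - \<eta>)-lipschitz_on UNIV f"
      using Lip_le[of "Lip f - \<eta>" f] \<open>\<eta> > 0\<close> by linarith
    then obtain a b where ab: "a \<le> b" "\<bar>f a - f b\<bar> > (Lip f - \<eta>) * (b - a)"
      using False lipschitz_on_leI[of UNIV f "Lip f - \<eta>"] by (force simp: dist_real_def)
    then have "a < b"
      by (cases "a = b") auto
    show ?thesis
    proof (cases "f a < f b")
      case True
      obtain m where m: "\<And>y. f b + m * (y - b) \<le> f y"
        using supporting_line[OF conv, of b] by blast
      have "(Lip f - \<eta>) * (b - a) \<le> m * (b - a)"
        using m[of a] ab True by (simp add: algebra_simps)
      then have "Lip f - \<eta> \<le> m"
        using \<open>a < b\<close> by simp
      then show ?thesis
        using m by (intro exI[of _ m] exI[of _ b]) auto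
    next
      case False
      obtain m where m: "\<And>y. f a + m * (y - a) \<le> f y"
        using supporting_line[OF conv, of a] by blast
      have "(Lip f - \<eta>) * (b - a) \<le> (- m) * (b - a)"
        using m[of b] ab False by (simp add: algebra_simps)
      then have "Lip f - \<eta> \<le> - m"
        using \<open>a < b\<close> by (simp only: mult_le_cancel_right_pos diff_gt_0_iff_gt)
      then show ?thesis
        using m by (intro exI[of _ m] exI[of _ a]) auto
    qed
  qed
  then obtain m x where "\<And>y. f x + m * (y - x) \<le> f y" "Lip f - \<eta> \<le> \<bar>m\<bar>"
    by blast
  then show ?thesis
    by (intro that[of "f x - m * x" m]) (auto simp: algebra_simps)
qed

text \<open>Towards the end at which it decreases, a monotone function converges in the extended reals to
  its infimum. Here and at \<open>-\<infinity>\<close>, \<^term>\<open>Lim\<close> is therefore a genuine limit.\<close>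

lemma Lim_at_top_le:
  assumes "antimono f"
  shows "Lim at_top (\<lambda>t. ereal (f t)) \<le> ereal (f (x::real))"
proof -
  let ?l = "INF t. ereal (f t)"
  have "((\<lambda>t. ereal (f t)) \<longlongrightarrow> ?l) at_top"
  proof (rule order_tendstoI)
    fix a assume "a < ?l"
    then show "\<forall>\<^sub>F t in at_top. a < ereal (f t)"
      by (intro always_eventually allI less_INF_D[of a "\<lambda>t. ereal (f t)" UNIV]) auto
  next
    fix a assume "?l < a"
    then obtain u where u: "ereal (f u) < a"
      by (auto simp: INF_less_iff)
    show "\<forall>\<^sub>F t in at_top. ereal (f t) < a"
      using eventually_ge_at_top[of u]
    proof eventually_elim
      case (elim t)
      then have "ereal (f t) \<le> ereal (f u)"
        using assms by (auto dest: antimonoD)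
      then show ?case
        using u by (rule le_less_trans)
    qed
  qed
  then have "Lim at_top (\<lambda>t. ereal (f t)) = ?l"
    by (intro tendsto_Lim) auto
  then show ?thesis
    by (auto intro: INF_lower)
qed

lemma Lim_at_bot_le:
  assumes "mono f"
  shows "Lim at_bot (\<lambda>t. ereal (f t)) \<le> ereal (f (x::real))"
proof -
  let ?l = "INF t. ereal (f t)"
  have "((\<lambda>t. ereal (f t)) \<longlongrightarrow> ?l) at_bot"
  proof (rule order_tendstoI)
    fix a assume "a < ?l"
    then show "\<forall>\<^sub>F t in at_bot. a < ereal (f t)"
      by (intro always_eventually allI less_INF_D[of a "\<lambda>t. ereal (f t)" UNIV]) auto
  next
    fix a assume "?l < a"
    then obtain u where u: "ereal (f u) < a"
      by (auto simp: INF_less_iff)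
    show "\<forall>\<^sub>F t in at_bot. ereal (f t) < a"
      using eventually_le_at_bot[of u]
    proof eventually_elim
      case (elim t)
      then have "ereal (f t) \<le> ereal (f u)"
        using assms by (auto dest: monoD)
      then show ?case
        using u by (rule le_less_trans)
    qed
  qed
  then have "Lim at_bot (\<lambda>t. ereal (f t)) = ?l"
    by (intro tendsto_Lim) auto
  then show ?thesis
    by (auto intro: INF_lower)
qed

text \<open>Replacing \<open>f\<close> by its monotone envelopes does not change the maximum over the two end points:
  the envelope that was flattened takes the value at the minimiser \<open>t0\<close> (or the infimum of \<open>f\<close> as a
  limit), which the other end point dominates. So the second term of the robust value is the average
  of the maxima of \<open>f\<close> over intervals of radius \<open>\<epsilon>\<close> times the dual norm.\<close>

lemma max_f1_f2:
  assumes conv: "convex_on UNIV f"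
    and anti: "antimono_on {t. ereal t < t0} f" and mono: "mono_on {t. t0 < ereal t} f"
    and "0 \<le> r"
  shows "max (f1 f t0 (s - r)) (f2 f t0 (s + r)) = ereal (max (f (s - r)) (f (s + r)))"
proof (cases t0)
  case (real z)
  have cont: "isCont f z"
    using convex_on_continuous[OF open_UNIV conv] by (simp add: continuous_on_eq_continuous_at)
  \<comment> \<open>The monotonicity assumptions exclude the point \<open>z\<close> itself; continuity adds it.\<close>
  have left: "f b \<le> f a" if "a \<le> b" "b \<le> z" for a b
  proof (cases "b = z")
    case True
    have "\<forall>\<^sub>F t in at_left z. f t \<le> f a" if "a < z"
      using eventually_at_left_real[OF \<open>a < z\<close>] anti real
      by (auto elim!: eventually_mono simp: monotone_on_def)
    then show ?thesis
      using tendsto_upperbound[of f "f z" "at_left z" "f a"] cont True \<open>a \<le> b\<close>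
      by (cases "a = z") (auto simp: isCont_def intro: tendsto_within_subset)
  next
    case False
    then show ?thesis using that anti real by (auto simp: monotone_on_def)
  qed
  have right: "f a \<le> f b" if "a \<le> b" "z \<le> a" for a b
  proof (cases "a = z")
    case True
    have "\<forall>\<^sub>F t in at_right z. f t \<le> f b" if "z < b"
      using eventually_at_right_real[OF \<open>z < b\<close>] mono real
      by (auto elim!: eventually_mono simp: monotone_on_def)
    then show ?thesis
      using tendsto_upperbound[of f "f z" "at_right z" "f b"] cont True \<open>a \<le> b\<close>
      by (cases "b = z") (auto simp: isCont_def intro: tendsto_within_subset)
  next
    case False
    then show ?thesis using that mono real by (auto simp: monotone_on_def)
  qed
  show ?thesis
    using real \<open>0 \<le> r\<close> left[of "s - r" "s + r"] left[of "s - r" z] left[of "s + r" z]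
      right[of "s - r" "s + r"] right[of z "s - r"] right[of z "s + r"]
    unfolding f1_def f2_def at_ereal_def
    by (cases "s - r < z"; cases "s + r \<le> z"; cases "s = z \<and> r = 0") (auto simp: max_def)
next
  case PInf
  then have "antimono f"
    using anti by (auto simp: monotone_on_def)
  then show ?thesis
    using PInf Lim_at_top_le[of f "s + r"] antimonoD[of f "s - r" "s + r"] \<open>0 \<le> r\<close>
    unfolding f1_def f2_def at_ereal_def
    by (simp add: max_absorb1) (metis Lim_at_top_le max_absorb1)
next
  case MInf
  then have "mono f"
    using mono by (auto simp: monotone_on_def)
  then show ?thesis
    using MInf Lim_at_bot_le[of f "s + r"] monoD[of f "s - r" "s + r"] \<open>0 \<le> r\<close>
    unfolding f1_def f2_def at_ereal_def by (simp add: max_absorb2)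
qed

section \<open>Conditional value-at-risk through the quantile function\<close>

lemma ereal_integral_ereal:
  assumes "integrable M g"
  shows "ereal_integral M (\<lambda>\<omega>. ereal (g \<omega>)) = ereal (integral\<^sup>L M g)"
proof -
  have e2: "e2ennreal (ereal r) = ennreal r" for r
    by (simp add: ennreal.abs_eq)
  obtain p n where "0 \<le> p" "0 \<le> n" and
    pn: "(\<integral>\<^sup>+ \<omega>. ennreal (g \<omega>) \<partial>M) = ennreal p" "(\<integral>\<^sup>+ \<omega>. ennreal (- g \<omega>) \<partial>M) = ennreal n"
      "integral\<^sup>L M g = p - n"
    by (rule integrableE[OF assms])
  show ?thesis
    unfolding ereal_integral_def by (simp add: e2 pn \<open>0 \<le> p\<close> \<open>0 \<le> n\<close>)
qed

text \<open>The end points are Lebesgue null; removing them leaves the open unit interval, on which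
  quantiles are finite. At \<open>0\<close> the value-at-risk is \<open>-\<infinity>\<close>, at \<open>1\<close> it may be \<open>\<infinity>\<close>.\<close>

lemma nn_integral_tail_interval:
  assumes "0 \<le> \<alpha>" and eq: "\<And>u. 0 < u \<Longrightarrow> u < 1 \<Longrightarrow> \<alpha> \<le> u \<Longrightarrow> g u = h u"
  shows "(\<integral>\<^sup>+ u. g u \<partial>restrict_space lborel {\<alpha>..1}) =
    (\<integral>\<^sup>+ u. h u * indicator {\<alpha>..1} u \<partial>restrict_space lborel {0<..<1::real})"
proof -
  have "AE u in lborel. u \<noteq> 0 \<and> u \<noteq> (1::real)"
    using AE_lborel_singleton[of 0] AE_lborel_singleton[of 1] by eventually_elim simp
  then have "AE u in lborel. g u * indicator {\<alpha>..1} u = h u * indicator {\<alpha>..1} u * indicator {0<..<1} u"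
  proof eventually_elim
    case (elim u)
    then show ?case
      using \<open>0 \<le> \<alpha>\<close> eq[of u] by (auto simp: indicator_def)
  qed
  then have "(\<integral>\<^sup>+ u. g u * indicator {\<alpha>..1} u \<partial>lborel) =
      (\<integral>\<^sup>+ u. h u * indicator {\<alpha>..1} u * indicator {0<..<1} u \<partial>lborel)"
    by (rule nn_integral_cong_AE)
  then show ?thesis
    by (simp add: nn_integral_restrict_space)
qed

lemma nn_integral_const_tail:
  assumes "0 \<le> \<alpha>" "\<alpha> < 1" "0 \<le> r"
  shows "(\<integral>\<^sup>+ u. ennreal r * indicator {\<alpha>..1} u \<partial>restrict_space lborel {0<..<1::real}) = ennreal ((1 - \<alpha>) * r)"
proof -
  have "(\<integral>\<^sup>+ u. ennreal r \<partial>restrict_space lborel {\<alpha>..1::real}) = ennreal ((1 - \<alpha>) * r)"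
    using assms by (simp add: emeasure_restrict_space space_restrict_space ennreal_mult mult.commute)
  then show ?thesis
    using nn_integral_tail_interval[OF \<open>0 \<le> \<alpha>\<close>, of "\<lambda>_. ennreal r" "\<lambda>_. ennreal r"] by simp
qed

definition quantile :: "'a measure \<Rightarrow> ('a \<Rightarrow> real) \<Rightarrow> real \<Rightarrow> real" where
  "quantile M X u = Inf {x. u \<le> cdf (distr M borel X) x}"

context
  fixes M :: "'a measure" and X :: "'a \<Rightarrow> real"
  assumes prob: "prob_space M" and X[measurable]: "X \<in> borel_measurable M"
begin

interpretation M: prob_space M by (rule prob)

interpretation D: cdf_distribution "distr M borel X"
  unfolding cdf_distribution_def by (intro M.real_distribution_distr X)

lemma le_cdf_iff_quantile_le:
  assumes "0 < u" "u < 1"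
  shows "u \<le> measure M {\<omega> \<in> space M. X \<omega> \<le> x} \<longleftrightarrow> quantile M X u \<le> x"
proof -
  have "measure M {\<omega> \<in> space M. X \<omega> \<le> x} = cdf (distr M borel X) x"
    by (simp add: cdf_def measure_distr vimage_def Int_def conj_commute)
  then show ?thesis
    unfolding quantile_def using D.pseudoinverse[OF assms, of x] by metis
qed

lemma VaR_eq_quantile:
  assumes "0 < u" "u < 1"
  shows "VaR u M X = ereal (quantile M X u)"
  unfolding VaR_def using le_cdf_iff_quantile_le[OF assms]
  by (intro Inf_eqI) auto

lemma quantile_mono:
  assumes "0 < u" "u \<le> v" "v < 1"
  shows "quantile M X u \<le> quantile M X v"
  using mono_onD[OF D.mono_I, of u v] assms unfolding quantile_def by auto

lemma quantile_nonneg: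
  assumes "0 < u" "u < 1" and nn: "\<forall>\<omega>\<in>space M. 0 \<le> X \<omega>"
  shows "0 \<le> quantile M X u"
proof (rule ccontr)
  let ?A = "{\<omega> \<in> space M. X \<omega> \<le> quantile M X u}"
  assume "\<not> 0 \<le> quantile M X u"
  then have "?A = {}"
    using nn by force
  then have "measure M ?A = 0" by (simp only: measure_empty)
  then show False
    using le_cdf_iff_quantile_le[OF assms(1,2), of "quantile M X u"] \<open>0 < u\<close> by linarith
qed

lemma measurable_quantile[measurable]:
  "quantile M X \<in> borel_measurable (restrict_space borel {0<..<1})"
  unfolding quantile_def by (rule D.measurable_CI)

text \<open>Quantile transform: a uniform variable on \<open>(0, 1)\<close> composed with the quantile function has
  the law of \<open>X\<close>.\<close>

lemma nn_integral_quantile: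
  assumes [measurable]: "g \<in> borel_measurable borel"
  shows "(\<integral>\<^sup>+ u. g (quantile M X u) \<partial>restrict_space lborel {0<..<1}) = (\<integral>\<^sup>+ \<omega>. g (X \<omega>) \<partial>M)"
proof -
  have "(\<integral>\<^sup>+ \<omega>. g (X \<omega>) \<partial>M) = (\<integral>\<^sup>+ x. g x \<partial>distr M borel X)"
    by (simp add: nn_integral_distr)
  also have "\<dots> = (\<integral>\<^sup>+ x. g x \<partial>distr (restrict_space lborel {0<..<1}) borel D.I)"
    by (simp add: D.distr_I_eq_M)
  also have "\<dots> = (\<integral>\<^sup>+ u. g (quantile M X u) \<partial>restrict_space lborel {0<..<1})"
    unfolding quantile_def by (subst nn_integral_distr) auto
  finally show ?thesis ..
qed

lemma CVaR_eq_quantile: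
  assumes "0 \<le> \<alpha>" and nn: "\<forall>\<omega>\<in>space M. 0 \<le> X \<omega>"
  shows "CVaR \<alpha> M X = ereal (1 / (1 - \<alpha>)) *
    enn2ereal (\<integral>\<^sup>+ u. ennreal (quantile M X u) * indicator {\<alpha>..1} u \<partial>restrict_space lborel {0<..<1})"
proof -
  have "(\<integral>\<^sup>+ u. e2ennreal (VaR u M X) \<partial>restrict_space lborel {\<alpha>..1}) =
      (\<integral>\<^sup>+ u. ennreal (quantile M X u) * indicator {\<alpha>..1} u \<partial>restrict_space lborel {0<..<1})"
    using \<open>0 \<le> \<alpha>\<close>
    by (intro nn_integral_tail_interval) (auto simp: VaR_eq_quantile ennreal.abs_eq)
  moreover have "(\<integral>\<^sup>+ u. e2ennreal (- VaR u M X) \<partial>restrict_space lborel {\<alpha>..1}) = 0"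
  proof -
    have "e2ennreal (- VaR u M X) = 0" if "0 < u" "u < 1" for u
      using quantile_nonneg[OF that nn] that by (simp add: VaR_eq_quantile ennreal_neg)
    then have "(\<integral>\<^sup>+ u. e2ennreal (- VaR u M X) \<partial>restrict_space lborel {\<alpha>..1}) =
        (\<integral>\<^sup>+ u. 0 * indicator {\<alpha>..1} u \<partial>restrict_space lborel {0<..<1::real})"
      using \<open>0 \<le> \<alpha>\<close> by (intro nn_integral_tail_interval) auto
    then show ?thesis by simp
  qed
  ultimately show ?thesis
    unfolding CVaR_def ereal_integral_def by (simp add: zero_ennreal.rep_eq)
qed

text \<open>The upper tail of a nonnegative variable contributes at most the whole mean. Transport plans
  of mean cost \<open>(1 - \<alpha>) * \<epsilon>\<close> are therefore admissible, however concentrated the cost is.\<close>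

lemma CVaR_le_mean:
  assumes "0 \<le> \<alpha>" "\<alpha> < 1" and nn: "\<forall>\<omega>\<in>space M. 0 \<le> X \<omega>" and "integrable M X"
  shows "CVaR \<alpha> M X \<le> ereal (1 / (1 - \<alpha>) * (\<integral>\<omega>. X \<omega> \<partial>M))"
proof -
  have "(\<integral>\<^sup>+ u. ennreal (quantile M X u) * indicator {\<alpha>..1} u \<partial>restrict_space lborel {0<..<1})
     \<le> (\<integral>\<^sup>+ u. ennreal (quantile M X u) \<partial>restrict_space lborel {0<..<1})"
    by (intro nn_integral_mono) (auto simp: indicator_def)
  also have "\<dots> = (\<integral>\<^sup>+ \<omega>. ennreal (X \<omega>) \<partial>M)"
    by (intro nn_integral_quantile) simp
  also have "\<dots> = ennreal (\<integral>\<omega>. X \<omega> \<partial>M)"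
    using nn by (intro nn_integral_eq_integral assms) auto
  finally have "enn2ereal (\<integral>\<^sup>+ u. ennreal (quantile M X u) * indicator {\<alpha>..1} u \<partial>restrict_space lborel {0<..<1})
     \<le> enn2ereal (ennreal (\<integral>\<omega>. X \<omega> \<partial>M))"
    by (simp only: less_eq_ennreal.rep_eq)
  also have "\<dots> = ereal (\<integral>\<omega>. X \<omega> \<partial>M)"
    using nn by (intro enn2ereal_ennreal integral_nonneg_AE) auto
  finally show ?thesis
    unfolding CVaR_eq_quantile[OF \<open>0 \<le> \<alpha>\<close> nn] times_ereal.simps(1)[symmetric]
    using \<open>\<alpha> < 1\<close> by (intro ereal_mult_left_mono) auto
qed

lemma CVaR_le_bound:
  assumes "0 \<le> \<alpha>" "\<alpha> < 1" and nn: "\<forall>\<omega>\<in>space M. 0 \<le> X \<omega>"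
    and "\<forall>\<omega>\<in>space M. X \<omega> \<le> c"
  shows "CVaR \<alpha> M X \<le> ereal c"
proof -
  have "space M \<noteq> {}" by (rule M.not_empty)
  then have "0 \<le> c" using nn assms(4) by (metis ex_in_conv order_trans)
  have "{\<omega> \<in> space M. X \<omega> \<le> c} = space M"
    using assms(4) by auto
  then have q: "quantile M X u \<le> c" if "0 < u" "u < 1" for u
    using le_cdf_iff_quantile_le[OF that, of c] that by (simp add: M.prob_space)
  have "(\<integral>\<^sup>+ u. ennreal (quantile M X u) * indicator {\<alpha>..1} u \<partial>restrict_space lborel {0<..<1})
     \<le> (\<integral>\<^sup>+ u. ennreal c * indicator {\<alpha>..1} u \<partial>restrict_space lborel {0<..<1})"
    by (intro nn_integral_mono) (auto simp: space_restrict_space indicator_def q ennreal_leI)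
  also have "\<dots> = ennreal (c * (1 - \<alpha>))"
    using \<open>\<alpha> < 1\<close> \<open>0 \<le> \<alpha>\<close> \<open>0 \<le> c\<close> by (simp add: nn_integral_const_tail mult.commute)
  finally have "enn2ereal (\<integral>\<^sup>+ u. ennreal (quantile M X u) * indicator {\<alpha>..1} u \<partial>restrict_space lborel {0<..<1})
     \<le> enn2ereal (ennreal (c * (1 - \<alpha>)))"
    by (simp only: less_eq_ennreal.rep_eq)
  also have "\<dots> = ereal (c * (1 - \<alpha>))"
    using \<open>\<alpha> < 1\<close> \<open>0 \<le> c\<close> by (intro enn2ereal_ennreal) auto
  finally have "CVaR \<alpha> M X \<le> ereal (1 / (1 - \<alpha>)) * ereal (c * (1 - \<alpha>))"
    unfolding CVaR_eq_quantile[OF \<open>0 \<le> \<alpha>\<close> nn]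
    using \<open>\<alpha> < 1\<close> by (intro ereal_mult_left_mono) auto
  then show ?thesis
    using \<open>\<alpha> < 1\<close> by simp
qed

text \<open>One half of the Rockafellar-Uryasev formula, with the threshold \<open>\<tau>\<close> equal to the
  \<open>\<alpha>\<close>-quantile: for \<open>u \<ge> \<alpha>\<close> the quantile is \<open>\<tau>\<close> plus its excess over \<open>\<tau>\<close>, and for \<open>u < \<alpha>\<close> there is
  no excess, so the tail integral equals \<open>(1 - \<alpha>) * \<tau>\<close> plus the mean excess of \<open>X\<close>.\<close>

lemma CVaR_threshold:
  assumes "0 \<le> \<alpha>" "\<alpha> < 1" and nn: "\<forall>\<omega>\<in>space M. 0 \<le> X \<omega>"
    and le: "CVaR \<alpha> M X \<le> ereal c"
  obtains \<tau> where "0 \<le> \<tau>" "integrable M X"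
    "(1 - \<alpha>) * \<tau> + (\<integral>\<omega>. max 0 (X \<omega> - \<tau>) \<partial>M) \<le> (1 - \<alpha>) * c"
proof -
  \<comment> \<open>The quantile function is meaningful on the open unit interval only; for a nonnegative
    variable, \<open>0\<close> serves as its value at \<open>0\<close>.\<close>
  define \<tau> where "\<tau> = (if \<alpha> = 0 then 0 else quantile M X \<alpha>)"
  let ?U = "restrict_space lborel {0<..<1::real}"
  let ?T = "\<integral>\<^sup>+ u. ennreal (quantile M X u) * indicator {\<alpha>..1} u \<partial>?U"
  have q0: "0 \<le> quantile M X u" if "0 < u" "u < 1" for u
    by (rule quantile_nonneg[OF that nn])
  have \<tau>: "0 \<le> \<tau>"
    using assms(1,2) q0[of \<alpha>] by (cases "\<alpha> = 0") (simp_all add: \<tau>_def)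
  have le\<tau>: "\<tau> \<le> quantile M X u" if "\<alpha> \<le> u" "0 < u" "u < 1" for u
  proof (cases "\<alpha> = 0")
    case True
    then show ?thesis using q0[OF that(2,3)] by (simp add: \<tau>_def)
  next
    case False
    then show ?thesis using quantile_mono[OF _ that(1,3)] assms(1) by (simp add: \<tau>_def)
  qed
  have ge\<tau>: "quantile M X u \<le> \<tau>" if "u < \<alpha>" "0 < u" for u
    using quantile_mono[of u \<alpha>] that assms(2) by (simp add: \<tau>_def)
  have "0 \<le> c"
  proof -
    have "0 \<le> CVaR \<alpha> M X"
      unfolding CVaR_eq_quantile[OF \<open>0 \<le> \<alpha>\<close> nn] using \<open>\<alpha> < 1\<close> by auto
    with le show ?thesis by (metis ereal_less_eq(3) order_trans zero_ereal_def)
  qed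
  have "enn2ereal ?T \<le> ereal ((1 - \<alpha>) * c)"
    using le \<open>\<alpha> < 1\<close> unfolding CVaR_eq_quantile[OF \<open>0 \<le> \<alpha>\<close> nn]
    by (cases "enn2ereal ?T") (auto simp: field_simps)
  then have "?T \<le> ennreal ((1 - \<alpha>) * c)"
    using \<open>\<alpha> < 1\<close> \<open>0 \<le> c\<close> by (simp add: less_eq_ennreal.rep_eq)
  moreover have "ennreal ((1 - \<alpha>) * \<tau>) + (\<integral>\<^sup>+ \<omega>. ennreal (max 0 (X \<omega> - \<tau>)) \<partial>M) \<le> ?T"
  proof -
    have "(\<integral>\<^sup>+ u. ennreal \<tau> * indicator {\<alpha>..1} u \<partial>?U) = ennreal ((1 - \<alpha>) * \<tau>)"
      using assms(1,2) \<tau> by (rule nn_integral_const_tail)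
    moreover have "(\<integral>\<^sup>+ u. ennreal (max 0 (quantile M X u - \<tau>)) \<partial>?U) = (\<integral>\<^sup>+ \<omega>. ennreal (max 0 (X \<omega> - \<tau>)) \<partial>M)"
      by (rule nn_integral_quantile) simp
    moreover have "(\<integral>\<^sup>+ u. ennreal \<tau> * indicator {\<alpha>..1} u \<partial>?U) + (\<integral>\<^sup>+ u. ennreal (max 0 (quantile M X u - \<tau>)) \<partial>?U) 
        = (\<integral>\<^sup>+ u. ennreal \<tau> * indicator {\<alpha>..1} u + ennreal (max 0 (quantile M X u - \<tau>)) \<partial>?U)"
      by (rule nn_integral_add[symmetric]) (auto intro!: measurable_restrict_space1)
    moreover have "\<dots> \<le> ?T"
    proof (rule nn_integral_mono)
      fix u assume "u \<in> space ?U"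
      then have u: "0 < u" "u < 1" by (auto simp: space_restrict_space)
      show "ennreal \<tau> * indicator {\<alpha>..1} u + ennreal (max 0 (quantile M X u - \<tau>))
          \<le> ennreal (quantile M X u) * indicator {\<alpha>..1} u"
        using u \<tau> le\<tau>[of u] ge\<tau>[of u]
        by (cases "\<alpha> \<le> u") (auto simp: indicator_def simp flip: ennreal_plus)
    qed
    ultimately show ?thesis by simp
  qed
  ultimately have *: "ennreal ((1 - \<alpha>) * \<tau>) + (\<integral>\<^sup>+ \<omega>. ennreal (max 0 (X \<omega> - \<tau>)) \<partial>M) \<le> ennreal ((1 - \<alpha>) * c)"
    by (rule order_trans[rotated])
  then have "(\<integral>\<^sup>+ \<omega>. ennreal (max 0 (X \<omega> - \<tau>)) \<partial>M) < \<infinity>"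
    by (metis add_increasing ennreal_less_top infinity_ennreal_def le_less_trans order_refl zero_le)
  then have int: "integrable M (\<lambda>\<omega>. max 0 (X \<omega> - \<tau>))"
    by (intro integrableI_nonneg) auto
  have "integrable M X"
  proof (rule Bochner_Integration.integrable_bound)
    show "integrable M (\<lambda>\<omega>. max 0 (X \<omega> - \<tau>) + \<tau>)"
      using int by simp
  qed (use nn \<tau> in \<open>auto intro!: AE_I2\<close>)
  moreover have "(1 - \<alpha>) * \<tau> + (\<integral>\<omega>. max 0 (X \<omega> - \<tau>) \<partial>M) \<le> (1 - \<alpha>) * c"
  proof -
    have "(\<integral>\<^sup>+ \<omega>. ennreal (max 0 (X \<omega> - \<tau>)) \<partial>M) = ennreal (\<integral>\<omega>. max 0 (X \<omega> - \<tau>) \<partial>M)"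
      by (rule nn_integral_eq_integral[OF int]) auto
    moreover have "0 \<le> (\<integral>\<omega>. max 0 (X \<omega> - \<tau>) \<partial>M)"
      by simp
    ultimately show ?thesis
      using * \<tau> \<open>\<alpha> < 1\<close> \<open>0 \<le> c\<close> by (simp flip: ennreal_plus)
  qed
  ultimately show ?thesis
    using that \<tau> by blast
qed

end

section \<open>Transport plans from the empirical distribution\<close>

lemma CVaR_distr:
  assumes [measurable]: "g \<in> measurable M N" "Z \<in> borel_measurable N"
  shows "CVaR \<alpha> (distr M N g) Z = CVaR \<alpha> M (\<lambda>\<omega>. Z (g \<omega>))"
proof -
  have "measure (distr M N g) {\<omega> \<in> space N. Z \<omega> \<le> r} = measure M {\<omega> \<in> space M. Z (g \<omega>) \<le> r}" for r
  proof -
    have "g -` {\<omega> \<in> space N. Z \<omega> \<le> r} \<inter> space M = {\<omega> \<in> space M. Z (g \<omega>) \<le> r}"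
      using measurable_space[OF assms(1)] by blast
    then show ?thesis
      by (simp add: measure_distr)
  qed
  then show ?thesis
    unfolding CVaR_def VaR_def by simp
qed

lemma borel_measurable_is_norm:
  fixes nrm :: "'a::euclidean_space \<Rightarrow> real"
  assumes "is_norm nrm"
  shows "nrm \<in> borel_measurable borel"
  using is_norm_continuous[OF assms] by (rule borel_measurable_continuous_onI)

lemma distr_in_CVaR_ball:
  fixes nrm :: "'a::euclidean_space \<Rightarrow> real"
  assumes "is_norm nrm" "prob_space M"
    and [measurable]: "X \<in> borel_measurable M" "Y \<in> borel_measurable M"
    and le: "CVaR \<alpha> M (\<lambda>\<omega>. nrm (X \<omega> - Y \<omega>)) \<le> ereal \<epsilon>"
  shows "distr M borel Y \<in> CVaR_ball nrm \<alpha> \<epsilon> (distr M borel X)"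
proof -
  interpret prob_space M by fact
  note [measurable] = borel_measurable_is_norm[OF \<open>is_norm nrm\<close>]
  let ?Q = "distr M (borel \<Otimes>\<^sub>M borel) (\<lambda>\<omega>. (X \<omega>, Y \<omega>))"
  have "?Q \<in> couplings (distr M borel X) (distr M borel Y)"
    unfolding couplings_def by (auto simp: distr_distr comp_def intro!: prob_space_distr)
  moreover have "CVaR \<alpha> ?Q (\<lambda>(\<xi>1, \<xi>2). nrm (\<xi>1 - \<xi>2)) \<le> ereal \<epsilon>"
    using le by (subst CVaR_distr) auto
  ultimately have "d_CVaR nrm \<alpha> (distr M borel X) (distr M borel Y) \<le> ereal \<epsilon>"
    unfolding d_CVaR_def by (rule INF_lower2)
  then show ?thesis
    unfolding CVaR_ball_def by (auto intro!: prob_space_distr)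
qed

lemma empirical_eq_distr_pmf:
  assumes "N \<ge> 1"
  shows "empirical N \<xi>s = distr (measure_pmf (pmf_of_set {1..N})) borel \<xi>s"
proof (rule measure_eqI)
  fix A assume "A \<in> sets (empirical N \<xi>s)"
  then have A: "A \<in> sets borel" by (simp add: empirical_def)
  have "emeasure (empirical N \<xi>s) A = emeasure (uniform_count_measure {1..N}) (\<xi>s -` A \<inter> {1..N})"
    unfolding empirical_def using A
    by (subst emeasure_distr) (auto simp: measurable_def space_uniform_count_measure
        sets_uniform_count_measure)
  also have "\<dots> = emeasure (measure_pmf (pmf_of_set {1..N})) (\<xi>s -` A)"
    using assms by (subst emeasure_uniform_count_measure) (auto simp: emeasure_pmf_of_set Int_commute
        ennreal_of_nat_eq_real_of_nat divide_ennreal)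
  also have "\<dots> = emeasure (distr (measure_pmf (pmf_of_set {1..N})) borel \<xi>s) A"
    using A by (simp add: emeasure_distr)
  finally show "emeasure (empirical N \<xi>s) A = \<dots>" .
qed (simp add: empirical_def)

lemma
  fixes g :: "'a::euclidean_space \<Rightarrow> real"
  assumes "N \<ge> 1" and g[measurable]: "g \<in> borel_measurable borel"
  shows integrable_empirical: "integrable (empirical N \<xi>s) g"
    and integral_empirical: "(\<integral>\<xi>. g \<xi> \<partial>empirical N \<xi>s) = (1 / real N) * (\<Sum>i=1..N. g (\<xi>s i))"
proof -
  show "integrable (empirical N \<xi>s) g"
    unfolding empirical_eq_distr_pmf[OF assms(1)] using assms(1)
    by (auto simp: integrable_distr_eq intro!: integrable_measure_pmf_finite)
  show "(\<integral>\<xi>. g \<xi> \<partial>empirical N \<xi>s) = (1 / real N) * (\<Sum>i=1..N. g (\<xi>s i))"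
    unfolding empirical_eq_distr_pmf[OF assms(1)] using assms(1)
    by (simp add: integral_distr integral_pmf_of_set)
qed

section \<open>Upper bound on the worst-case expectation\<close>

text \<open>A displacement of size at most \<open>c * \<tau>\<close> is paid for by convexity (the maximum over an
  interval is attained at an end point), the remaining excess by the Lipschitz constant.\<close>

lemma convex_lipschitz_displacement:
  assumes conv: "convex_on UNIV f" and lip: "L-lipschitz_on UNIV f"
    and "0 \<le> c" "0 \<le> \<tau>" and y: "\<bar>y - s\<bar> \<le> c * z"
  shows "f y \<le> max (f (s - c * \<tau>)) (f (s + c * \<tau>)) + L * (c * max 0 (z - \<tau>))"
proof -
  have "0 \<le> L" using lip by (rule lipschitz_on_nonneg)
  have far: "f y \<le> f b + L * (c * max 0 (z - \<tau>))" if "\<bar>y - b\<bar> \<le> c * (z - \<tau>)" for b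
  proof -
    have "f y - f b \<le> L * \<bar>y - b\<bar>"
      using lipschitz_onD[OF lip, of y b] by (simp add: dist_real_def)
    also have "\<dots> \<le> L * (c * max 0 (z - \<tau>))"
      using that \<open>0 \<le> L\<close> \<open>0 \<le> c\<close> 
      by (intro mult_left_mono order_trans[OF that] mult_left_mono) auto
    finally show ?thesis by simp
  qed
  have nn: "0 \<le> L * (c * max 0 (z - \<tau>))"
    using \<open>0 \<le> L\<close> \<open>0 \<le> c\<close> by simp
  consider "\<bar>y - s\<bar> \<le> c * \<tau>" | "y < s - c * \<tau>" | "s + c * \<tau> < y"
    by linarith
  then show ?thesis
  proof cases
    case 1
    then have "y \<in> {s - c * \<tau>..s + c * \<tau>}" by auto
    then have "f y \<le> max (f (s - c * \<tau>)) (f (s + c * \<tau>))"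
      using convex_on_le_max[of "s - c * \<tau>" "s + c * \<tau>" f y] conv by (auto intro: convex_on_subset)
    then show ?thesis using nn by linarith
  next
    case 2
    have "f y \<le> f (s - c * \<tau>) + L * (c * max 0 (z - \<tau>))"
      using 2 y by (intro far) (simp add: right_diff_distrib)
    then show ?thesis by linarith
  next
    case 3
    have "f y \<le> f (s + c * \<tau>) + L * (c * max 0 (z - \<tau>))"
      using 3 y by (intro far) (simp add: right_diff_distrib)
    then show ?thesis by linarith
  qed
qed

text \<open>Split the displacement at the threshold \<open>\<tau>\<close> of the transport cost. The part below \<open>\<tau>\<close>
  contributes the average of the end point maxima with radius \<open>\<tau>\<close>, and the excess contributes at most
  \<open>L * c * (1 - \<alpha>) * (e - \<tau>)\<close>. The sum is convex in \<open>\<tau> \<in> {0..e}\<close>, hence bounded by its values at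
  \<open>\<tau> = 0\<close> and \<open>\<tau> = e\<close>, which are the two terms of the robust value.\<close>

lemma coupling_upper_bound:
  fixes nrm :: "'a::euclidean_space \<Rightarrow> real" and x :: 'a
  assumes nrm: "is_norm nrm" and "N \<ge> 1" "0 \<le> \<alpha>" "\<alpha> < 1" "0 < e"
    and conv: "convex_on UNIV f" and lip: "L-lipschitz_on UNIV f"
    and Q: "Q \<in> couplings (empirical N \<xi>s) P"
    and le: "CVaR \<alpha> Q (\<lambda>(\<xi>1, \<xi>2). nrm (\<xi>1 - \<xi>2)) \<le> ereal e"
  defines "c \<equiv> dual_norm nrm x"
  shows "ereal_integral P (\<lambda>\<xi>. ereal (f (x \<bullet> \<xi>))) \<le>
    ereal (max ((1 / real N) * (\<Sum>i=1..N. f (x \<bullet> \<xi>s i)) + L * c * (1 - \<alpha>) * e)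
      ((1 / real N) * (\<Sum>i=1..N. max (f (x \<bullet> \<xi>s i - e * c)) (f (x \<bullet> \<xi>s i + e * c)))))"
proof -
  have "prob_space Q" and sets_Q[measurable_cong]: "sets Q = sets (borel \<Otimes>\<^sub>M borel)"
    and Q1: "distr Q borel fst = empirical N \<xi>s" and Q2: "distr Q borel snd = P"
    using Q by (auto simp: couplings_def)
  interpret prob_space Q by fact
  note [measurable] = borel_measurable_is_norm[OF nrm]
  have [measurable]: "f \<in> borel_measurable borel"
    using convex_on_continuous[OF open_UNIV conv] by (rule borel_measurable_continuous_onI)
  have "0 \<le> c" "0 \<le> L"
    using dual_norm_nonneg[OF nrm] lipschitz_on_nonneg[OF lip] by (simp_all add: c_def)
  have marginal: "integrable Q (\<lambda>q. g (fst q))"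
      "(\<integral>q. g (fst q) \<partial>Q) = (1 / real N) * (\<Sum>i=1..N. g (\<xi>s i))"
    if [measurable]: "g \<in> borel_measurable borel" for g :: "'a \<Rightarrow> real"
    using integrable_empirical[OF \<open>N \<ge> 1\<close> that, of \<xi>s] integral_empirical[OF \<open>N \<ge> 1\<close> that, of \<xi>s]
    unfolding Q1[symmetric] by (simp_all add: integrable_distr_eq integral_distr)
  define Z where "Z = (\<lambda>q::'a \<times> 'a. nrm (fst q - snd q))"
  have [measurable]: "Z \<in> borel_measurable Q"
    unfolding Z_def by measurable
  have "\<forall>q\<in>space Q. 0 \<le> Z q"
    using nrm by (simp add: Z_def is_norm_nonneg)
  moreover have "CVaR \<alpha> Q Z \<le> ereal e"
    using le by (simp add: Z_def case_prod_beta')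
  ultimately obtain \<tau> where "0 \<le> \<tau>" and intZ: "integrable Q Z"
    and \<tau>: "(1 - \<alpha>) * \<tau> + (\<integral>q. max 0 (Z q - \<tau>) \<partial>Q) \<le> (1 - \<alpha>) * e"
    using CVaR_threshold[OF \<open>prob_space Q\<close> \<open>Z \<in> borel_measurable Q\<close> \<open>0 \<le> \<alpha>\<close> \<open>\<alpha> < 1\<close>] by blast
  have "0 \<le> (\<integral>q. max 0 (Z q - \<tau>) \<partial>Q)" by simp
  then have "(1 - \<alpha>) * \<tau> \<le> (1 - \<alpha>) * e" using \<tau> by linarith
  then have "\<tau> \<le> e" using \<open>\<alpha> < 1\<close> by simp
  have dist: "\<bar>x \<bullet> snd q - x \<bullet> fst q\<bar> \<le> c * Z q" for q
    using inner_le_dual_norm[OF nrm, of x "fst q - snd q"]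
    by (simp add: c_def Z_def inner_diff_right abs_minus_commute)
  define G where "G = (\<lambda>s r. max (f (s - c * r)) (f (s + c * r)))"
  have intf: "integrable Q (\<lambda>q. f (x \<bullet> snd q))"
  proof (rule Bochner_Integration.integrable_bound)
    show "integrable Q (\<lambda>q. \<bar>f (x \<bullet> fst q)\<bar> + L * (c * Z q))"
      using intZ marginal(1)[of "\<lambda>v. \<bar>f (x \<bullet> v)\<bar>"] by simp
    have "\<bar>f (x \<bullet> snd q)\<bar> \<le> \<bar>f (x \<bullet> fst q)\<bar> + L * (c * Z q)" for q
    proof -
      have "\<bar>f (x \<bullet> snd q) - f (x \<bullet> fst q)\<bar> \<le> L * \<bar>x \<bullet> snd q - x \<bullet> fst q\<bar>"
        using lipschitz_onD[OF lip] by (simp add: dist_real_def)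
      also have "\<dots> \<le> L * (c * Z q)"
        using dist \<open>0 \<le> L\<close> by (intro mult_left_mono)
      finally show ?thesis by linarith
    qed
    then show "AE q in Q. norm (f (x \<bullet> snd q)) \<le> norm (\<bar>f (x \<bullet> fst q)\<bar> + L * (c * Z q))"
      by (intro AE_I2) (metis abs_ge_self order_trans real_norm_def)
  qed measurable
  have intG: "integrable Q (\<lambda>q. G (x \<bullet> fst q) \<tau>)"
    "(\<integral>q. G (x \<bullet> fst q) \<tau> \<partial>Q) = (1 / real N) * (\<Sum>i=1..N. G (x \<bullet> \<xi>s i) \<tau>)"
    using marginal[of "\<lambda>v. G (x \<bullet> v) \<tau>"] unfolding G_def by auto
  have "(\<integral>q. f (x \<bullet> snd q) \<partial>Q) \<le> (\<integral>q. G (x \<bullet> fst q) \<tau> + L * (c * max 0 (Z q - \<tau>)) \<partial>Q)"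
    unfolding G_def using intG(1) intZ
    by (intro integral_mono intf convex_lipschitz_displacement[OF conv lip \<open>0 \<le> c\<close> \<open>0 \<le> \<tau>\<close> dist])
       (auto simp: G_def)
  also have "\<dots> = (1 / real N) * (\<Sum>i=1..N. G (x \<bullet> \<xi>s i) \<tau>) + L * (c * (\<integral>q. max 0 (Z q - \<tau>) \<partial>Q))"
    using intG intZ by simp
  also have "\<dots> \<le> (1 / real N) * (\<Sum>i=1..N. G (x \<bullet> \<xi>s i) \<tau>) + L * (c * ((1 - \<alpha>) * (e - \<tau>)))"
    using \<tau> \<open>0 \<le> L\<close> \<open>0 \<le> c\<close> by (intro add_left_mono mult_left_mono) (auto simp: algebra_simps)
  also have "\<dots> \<le> max ((1 / real N) * (\<Sum>i=1..N. f (x \<bullet> \<xi>s i)) + L * c * (1 - \<alpha>) * e)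
      ((1 / real N) * (\<Sum>i=1..N. G (x \<bullet> \<xi>s i) e))" (is "_ \<le> max (?A + ?K) ?B")
  proof -
    define t where "t = \<tau> / e"
    have t: "0 \<le> t" "t \<le> 1" "\<tau> = t * e"
      using \<open>0 < e\<close> \<open>0 \<le> \<tau>\<close> \<open>\<tau> \<le> e\<close> by (simp_all add: t_def)
    have "G s \<tau> \<le> (1 - t) * f s + t * G s e" for s
    proof -
      have "f (s - c * \<tau>) \<le> (1 - t) * f s + t * f (s - c * e)"
        using convex_onD[OF conv t(1,2), of s "s - c * e"] by (simp add: t(3) algebra_simps)
      moreover have "f (s + c * \<tau>) \<le> (1 - t) * f s + t * f (s + c * e)"
        using convex_onD[OF conv t(1,2), of s "s + c * e"] by (simp add: t(3) algebra_simps)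
      moreover have "t * f (s - c * e) \<le> t * G s e" "t * f (s + c * e) \<le> t * G s e"
        using t by (auto simp: G_def intro!: mult_left_mono)
      moreover have "G s \<tau> = max (f (s - c * \<tau>)) (f (s + c * \<tau>))"
        by (simp add: G_def)
      ultimately show ?thesis by linarith
    qed
    then have "(1 / real N) * (\<Sum>i=1..N. G (x \<bullet> \<xi>s i) \<tau>) 
        \<le> (1 / real N) * (\<Sum>i=1..N. (1 - t) * f (x \<bullet> \<xi>s i) + t * G (x \<bullet> \<xi>s i) e)"
      by (intro mult_left_mono sum_mono) auto
    also have "\<dots> = (1 - t) * ?A + t * ?B"
      by (simp only: sum.distrib sum_distrib_left[symmetric]) (simp only: algebra_simps)
    finally have "(1 / real N) * (\<Sum>i=1..N. G (x \<bullet> \<xi>s i) \<tau>) + L * (c * ((1 - \<alpha>) * (e - \<tau>)))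
       \<le> (1 - t) * (?A + ?K) + t * ?B"
      by (simp add: t(3) algebra_simps)
    also have "\<dots> \<le> max (?A + ?K) ?B"
      using t(1,2) by (intro convex_bound_le[where u = "1 - t" and v = t] max.cobounded1 max.cobounded2) auto
    finally show ?thesis .
  qed
  finally have "(\<integral>\<xi>. f (x \<bullet> \<xi>) \<partial>P) \<le> max (?A + ?K) ?B"
    unfolding Q2[symmetric] by (simp add: integral_distr)
  moreover have "integrable P (\<lambda>\<xi>. f (x \<bullet> \<xi>))"
    unfolding Q2[symmetric] using intf by (simp add: integrable_distr_eq)
  ultimately show ?thesis
    by (simp add: ereal_integral_ereal G_def mult.commute del: ereal_max)
qed

section \<open>Nearly worst distributions\<close>

lemma ereal_integral_distr_pmf:
  fixes g :: "'b::euclidean_space \<Rightarrow> real"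
  assumes "finite (set_pmf \<mu>)" and [measurable]: "g \<in> borel_measurable borel"
  shows "ereal_integral (distr (measure_pmf \<mu>) borel Y) (\<lambda>\<xi>. ereal (g \<xi>)) =
    ereal (measure_pmf.expectation \<mu> (\<lambda>\<omega>. g (Y \<omega>)))"
  using assms(1)
  by (subst ereal_integral_ereal)
     (auto simp: integrable_distr_eq integral_distr intro!: integrable_measure_pmf_finite)

text \<open>Every atom moves by \<open>\<epsilon>\<close> times a maximiser of the dual norm, in the better of the two
  directions, so the transport cost is bounded by \<open>\<epsilon>\<close> and its CVaR as well.\<close>

lemma CVaR_ball_translation:
  fixes nrm :: "'a::euclidean_space \<Rightarrow> real" and x :: 'a
  assumes nrm: "is_norm nrm" and "N \<ge> 1" "0 \<le> \<epsilon>" "0 \<le> \<alpha>" "\<alpha> < 1"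
    and f[measurable]: "f \<in> borel_measurable borel"
  defines "c \<equiv> dual_norm nrm x"
  obtains P where "P \<in> CVaR_ball nrm \<alpha> \<epsilon> (empirical N \<xi>s)"
    "ereal_integral P (\<lambda>\<xi>. ereal (f (x \<bullet> \<xi>))) =
      ereal ((1 / real N) * (\<Sum>i=1..N. max (f (x \<bullet> \<xi>s i - \<epsilon> * c)) (f (x \<bullet> \<xi>s i + \<epsilon> * c))))"
proof -
  obtain v where v: "nrm v \<le> 1" "x \<bullet> v = c"
    using dual_norm_attained[OF nrm, of x] unfolding c_def by blast
  define \<sigma> where "\<sigma> = (\<lambda>i. if f (x \<bullet> \<xi>s i - \<epsilon> * c) \<le> f (x \<bullet> \<xi>s i + \<epsilon> * c) then 1 else - 1 :: real)"
  define Y where "Y = (\<lambda>i. \<xi>s i + (\<sigma> i * \<epsilon>) *\<^sub>R v)"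
  let ?\<mu> = "pmf_of_set {1..N}"
  have "nrm (\<xi>s i - Y i) \<le> \<epsilon>" for i
  proof -
    have "nrm (\<xi>s i - Y i) = nrm ((- (\<sigma> i * \<epsilon>)) *\<^sub>R v)"
      by (simp add: Y_def)
    also have "\<dots> = \<bar>- (\<sigma> i * \<epsilon>)\<bar> * nrm v"
      by (rule is_norm_scaleR[OF nrm])
    also have "\<dots> \<le> \<epsilon>"
      using v(1) \<open>0 \<le> \<epsilon>\<close> by (simp add: \<sigma>_def mult_left_le)
    finally show ?thesis .
  qed
  then have "CVaR \<alpha> (measure_pmf ?\<mu>) (\<lambda>i. nrm (\<xi>s i - Y i)) \<le> ereal \<epsilon>"
    using nrm by (intro CVaR_le_bound prob_space_measure_pmf assms) (auto simp: is_norm_nonneg)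
  then have "distr (measure_pmf ?\<mu>) borel Y \<in> CVaR_ball nrm \<alpha> \<epsilon> (empirical N \<xi>s)"
    unfolding empirical_eq_distr_pmf[OF \<open>N \<ge> 1\<close>]
    by (intro distr_in_CVaR_ball nrm prob_space_measure_pmf) auto
  moreover have "f (x \<bullet> Y i) = max (f (x \<bullet> \<xi>s i - \<epsilon> * c)) (f (x \<bullet> \<xi>s i + \<epsilon> * c))" for i
    by (simp add: Y_def \<sigma>_def v(2) inner_add_right max_def)
  then have "ereal_integral (distr (measure_pmf ?\<mu>) borel Y) (\<lambda>\<xi>. ereal (f (x \<bullet> \<xi>))) =
      ereal ((1 / real N) * (\<Sum>i=1..N. max (f (x \<bullet> \<xi>s i - \<epsilon> * c)) (f (x \<bullet> \<xi>s i + \<epsilon> * c))))"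
    using \<open>N \<ge> 1\<close> by (subst ereal_integral_distr_pmf) (auto simp: integral_pmf_of_set)
  ultimately show ?thesis
    by (rule that)
qed

lemma expectation_uniform_bernoulli:
  fixes h :: "nat \<times> bool \<Rightarrow> real"
  assumes "N \<ge> 1" "0 \<le> p" "p \<le> 1"
  shows "measure_pmf.expectation (pair_pmf (pmf_of_set {1..N}) (bernoulli_pmf p)) h =
    (1 / real N) * (\<Sum>i=1..N. (1 - p) * h (i, False) + p * h (i, True))"
proof -
  have "measure_pmf.expectation (pair_pmf (pmf_of_set {1..N}) (bernoulli_pmf p)) h =
    (\<Sum>z\<in>{1..N} \<times> UNIV. h z * pmf (pair_pmf (pmf_of_set {1..N}) (bernoulli_pmf p)) z)"
    using assms by (intro integral_measure_pmf_real) auto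
  also have "\<dots> = (\<Sum>i=1..N. \<Sum>b\<in>UNIV. h (i, b) * pmf (pair_pmf (pmf_of_set {1..N}) (bernoulli_pmf p)) (i, b))"
    by (simp add: sum.cartesian_product)
  also have "\<dots> = (\<Sum>i=1..N. (1 / real N) * ((1 - p) * h (i, False) + p * h (i, True)))"
    using assms by (intro sum.cong) (auto simp: UNIV_bool pmf_pair indicator_def field_simps)
  finally show ?thesis
    by (simp only: sum_distrib_left)
qed

text \<open>A fraction \<open>p\<close> of the mass of each atom moves by at most \<open>(1 - \<alpha>) * \<epsilon> / p\<close>, which keeps the
  mean transport cost at most \<open>(1 - \<alpha>) * \<epsilon>\<close>. Along a supporting line of slope \<open>m\<close> the gain in
  expectation does not depend on \<open>p\<close>, while the loss vanishes as \<open>p\<close> tends to \<open>0\<close>. The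
  Bernoulli coordinate of the sample space decides which part of an atom moves.\<close>

lemma CVaR_ball_escaping_mass:
  fixes nrm :: "'a::euclidean_space \<Rightarrow> real" and x :: 'a
  assumes nrm: "is_norm nrm" and "N \<ge> 1" "0 \<le> \<epsilon>" "0 \<le> \<alpha>" "\<alpha> < 1"
    and f[measurable]: "f \<in> borel_measurable borel"
    and line: "\<And>t. q + m * t \<le> f t" and p: "0 < p" "p \<le> 1"
  defines "c \<equiv> dual_norm nrm x"
  obtains P where "P \<in> CVaR_ball nrm \<alpha> \<epsilon> (empirical N \<xi>s)"
    "ereal ((1 - p) * ((1 / real N) * (\<Sum>i=1..N. f (x \<bullet> \<xi>s i)))
        + p * ((1 / real N) * (\<Sum>i=1..N. q + m * (x \<bullet> \<xi>s i))) + \<bar>m\<bar> * c * (1 - \<alpha>) * \<epsilon>)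
      \<le> ereal_integral P (\<lambda>\<xi>. ereal (f (x \<bullet> \<xi>)))"
proof -
  obtain v where v: "nrm v \<le> 1" "x \<bullet> v = c"
    using dual_norm_attained[OF nrm, of x] unfolding c_def by blast
  define D where "D = (1 - \<alpha>) * \<epsilon> / p"
  have "0 \<le> D" using assms by (simp add: D_def)
  \<comment> \<open>The sign selects the half-line on which the supporting line rises.\<close>
  define w where "w = (sgn m * D) *\<^sub>R v"
  have w: "nrm (- w) \<le> D" "m * (x \<bullet> w) = \<bar>m\<bar> * c * D"
  proof -
    have "nrm (- w) = nrm ((- (sgn m * D)) *\<^sub>R v)"
      by (simp add: w_def)
    also have "\<dots> = \<bar>- (sgn m * D)\<bar> * nrm v"
      by (rule is_norm_scaleR[OF nrm])
    also have "\<dots> \<le> D * 1"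
      using v(1) \<open>0 \<le> D\<close> is_norm_nonneg[OF nrm, of v]
      by (intro mult_mono) (auto simp: abs_mult sgn_if)
    finally show "nrm (- w) \<le> D" by simp
    show "m * (x \<bullet> w) = \<bar>m\<bar> * c * D"
      by (simp add: w_def v(2) abs_sgn ac_simps)
  qed
  define Y where "Y = (\<lambda>(i, b). \<xi>s i + (if b then w else 0))"
  let ?\<mu> = "pair_pmf (pmf_of_set {1..N}) (bernoulli_pmf p)"
  have fin: "finite (set_pmf ?\<mu>)"
    using \<open>N \<ge> 1\<close> by (auto intro: finite_subset[OF subset_UNIV])
  have X: "distr (measure_pmf ?\<mu>) borel (\<lambda>z. \<xi>s (fst z)) = empirical N \<xi>s"
  proof -
    have "distr (measure_pmf (map_pmf fst ?\<mu>)) borel \<xi>s = distr (measure_pmf ?\<mu>) borel (\<lambda>z. \<xi>s (fst z))"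
      unfolding map_pmf_rep_eq by (subst distr_distr) (auto simp: comp_def)
    then show ?thesis
      by (simp add: map_fst_pair_pmf empirical_eq_distr_pmf[OF \<open>N \<ge> 1\<close>])
  qed
  have "CVaR \<alpha> (measure_pmf ?\<mu>) (\<lambda>z. nrm (\<xi>s (fst z) - Y z))
      \<le> ereal (1 / (1 - \<alpha>) * measure_pmf.expectation ?\<mu> (\<lambda>z. nrm (\<xi>s (fst z) - Y z)))"
    using nrm fin
    by (intro CVaR_le_mean prob_space_measure_pmf assms integrable_measure_pmf_finite) (auto simp: is_norm_nonneg)
  also have "measure_pmf.expectation ?\<mu> (\<lambda>z. nrm (\<xi>s (fst z) - Y z)) = p * nrm (- w)"
    using p \<open>N \<ge> 1\<close>
    by (subst expectation_uniform_bernoulli) (simp_all add: Y_def is_norm_zero[OF nrm])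
  also have "ereal (1 / (1 - \<alpha>) * (p * nrm (- w))) \<le> ereal (1 / (1 - \<alpha>) * (p * D))"
    using p w(1) \<open>\<alpha> < 1\<close> unfolding ereal_less_eq(3) by (intro mult_left_mono) auto
  also have "1 / (1 - \<alpha>) * (p * D) = \<epsilon>"
    using p \<open>\<alpha> < 1\<close> by (simp add: D_def)
  finally have "distr (measure_pmf ?\<mu>) borel Y \<in> CVaR_ball nrm \<alpha> \<epsilon> (empirical N \<xi>s)"
    unfolding X[symmetric] by (intro distr_in_CVaR_ball nrm prob_space_measure_pmf) auto
  moreover have "ereal_integral (distr (measure_pmf ?\<mu>) borel Y) (\<lambda>\<xi>. ereal (f (x \<bullet> \<xi>))) =
      ereal ((1 / real N) * (\<Sum>i=1..N. (1 - p) * f (x \<bullet> \<xi>s i) + p * f (x \<bullet> \<xi>s i + x \<bullet> w)))"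
    using p \<open>N \<ge> 1\<close> fin
    by (subst ereal_integral_distr_pmf, simp_all del: One_nat_def)
       (subst expectation_uniform_bernoulli, auto simp: Y_def inner_add_right)
  moreover have "(1 - p) * ((1 / real N) * (\<Sum>i=1..N. f (x \<bullet> \<xi>s i)))
        + p * ((1 / real N) * (\<Sum>i=1..N. q + m * (x \<bullet> \<xi>s i))) + \<bar>m\<bar> * c * (1 - \<alpha>) * \<epsilon>
      \<le> (1 / real N) * (\<Sum>i=1..N. (1 - p) * f (x \<bullet> \<xi>s i) + p * f (x \<bullet> \<xi>s i + x \<bullet> w))"
  proof -
    have "\<bar>m\<bar> * c * (1 - \<alpha>) * \<epsilon> = p * (\<bar>m\<bar> * c * D)"
      using p by (simp add: D_def)
    then have "(1 - p) * ((1 / real N) * (\<Sum>i=1..N. f (x \<bullet> \<xi>s i)))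
        + p * ((1 / real N) * (\<Sum>i=1..N. q + m * (x \<bullet> \<xi>s i))) + \<bar>m\<bar> * c * (1 - \<alpha>) * \<epsilon>
      = (1 / real N) * (\<Sum>i=1..N. (1 - p) * f (x \<bullet> \<xi>s i) + p * (q + m * (x \<bullet> \<xi>s i) + \<bar>m\<bar> * c * D))"
      using \<open>N \<ge> 1\<close>
      by (simp only: sum.distrib sum_distrib_left[symmetric]) (simp add: field_simps)
    also have "\<dots> \<le> (1 / real N) * (\<Sum>i=1..N. (1 - p) * f (x \<bullet> \<xi>s i) + p * f (x \<bullet> \<xi>s i + x \<bullet> w))"
    proof (intro mult_left_mono sum_mono add_left_mono)
      fix i
      show "q + m * (x \<bullet> \<xi>s i) + \<bar>m\<bar> * c * D \<le> f (x \<bullet> \<xi>s i + x \<bullet> w)"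
        using line[of "x \<bullet> \<xi>s i + x \<bullet> w"] w(2) by (simp add: distrib_left)
    qed (use p in auto)
    finally show ?thesis .
  qed
  ultimately show ?thesis
    by (intro that) auto
qed

section \<open>The worst-case expectation\<close>

theorem corollary3:
  fixes nrm :: "real ^ 'm \<Rightarrow> real"
    and N :: nat and \<xi>s :: "nat \<Rightarrow> real ^ 'm"
    and \<epsilon> \<alpha> :: real and XX :: "(real ^ 'm) set"
    and f :: "real \<Rightarrow> real" and t0 :: ereal
  assumes "is_norm nrm"
    and "N \<ge> 1"
    and "\<epsilon> \<ge> 0"
    and "0 \<le> \<alpha>" and "\<alpha> < 1"
    and "convex_on UNIV f"
    and "\<exists>L. L-lipschitz_on UNIV f"
    and "antimono_on {t. ereal t < t0} f"
    and "mono_on {t. t0 < ereal t} f"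
  shows "\<forall>x\<in>XX.
    (SUP P\<in>CVaR_ball nrm \<alpha> \<epsilon> (empirical N \<xi>s). ereal_integral P (\<lambda>\<xi>. ereal (f (x \<bullet> \<xi>)))) =
    max (ereal ((1 / real N) * (\<Sum>i=1..N. f (x \<bullet> \<xi>s i))
                + Lip f * dual_norm nrm x * (1 - \<alpha>) * \<epsilon>))
        (ereal (1 / real N) *
           (\<Sum>i=1..N. max (f1 f t0 (x \<bullet> \<xi>s i - \<epsilon> * dual_norm nrm x))
                          (f2 f t0 (x \<bullet> \<xi>s i + \<epsilon> * dual_norm nrm x))))"
proof
  fix x assume "x \<in> XX"
  note nrm = assms(1) and conv = assms(6)
  define c where "c = dual_norm nrm x"
  define A where "A = (1 / real N) * (\<Sum>i=1..N. f (x \<bullet> \<xi>s i))"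
  define B where "B = (\<lambda>r. (1 / real N) * (\<Sum>i=1..N. max (f (x \<bullet> \<xi>s i - r * c)) (f (x \<bullet> \<xi>s i + r * c))))"
  let ?E = "\<lambda>P. ereal_integral P (\<lambda>\<xi>. ereal (f (x \<bullet> \<xi>)))"
  let ?S = "SUP P\<in>CVaR_ball nrm \<alpha> \<epsilon> (empirical N \<xi>s). ?E P"
  have lip: "(Lip f)-lipschitz_on UNIV f"
    using assms(7) by (rule lipschitz_on_Lip)
  have f: "f \<in> borel_measurable borel"
    using convex_on_continuous[OF open_UNIV conv] by (rule borel_measurable_continuous_onI)
  have c: "0 \<le> c"
    using dual_norm_nonneg[OF nrm] by (simp add: c_def)
  have L: "0 \<le> Lip f"
    using lip by (rule lipschitz_on_nonneg)
  have rhs: "ereal (1 / real N) * (\<Sum>i=1..N. max (f1 f t0 (x \<bullet> \<xi>s i - \<epsilon> * c)) (f2 f t0 (x \<bullet> \<xi>s i + \<epsilon> * c)))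
      = ereal (B \<epsilon>)"
    using c assms(3) by (simp only: max_f1_f2[OF conv assms(8,9)] mult_nonneg_nonneg sum_ereal times_ereal.simps B_def)
  have "?S = max (ereal (A + Lip f * c * (1 - \<alpha>) * \<epsilon>)) (ereal (B \<epsilon>))"
  proof (rule antisym)
    show "?S \<le> max (ereal (A + Lip f * c * (1 - \<alpha>) * \<epsilon>)) (ereal (B \<epsilon>))"
    proof (rule SUP_least, rule ereal_le_epsilon2)
      fix P and e :: real
      assume P: "P \<in> CVaR_ball nrm \<alpha> \<epsilon> (empirical N \<xi>s)"
      assume "0 < e"
      \<comment> \<open>The infimum over couplings need not be attained, so the radius is enlarged by \<open>\<delta>\<close>; the
        bound is Lipschitz in the radius with constant \<open>Lip f * c\<close>. Adding \<open>1\<close> to this constant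
        keeps the denominator positive.\<close>
      define \<delta> where "\<delta> = e / (Lip f * c + 1)"
      have "0 < Lip f * c + 1"
        using L c by (simp add: add_nonneg_pos)
      then have \<delta>: "0 < \<delta>" "Lip f * c * \<delta> \<le> e"
        using \<open>0 < e\<close> by (auto simp: \<delta>_def field_simps)
      have "d_CVaR nrm \<alpha> (empirical N \<xi>s) P < ereal (\<epsilon> + \<delta>)"
        using P \<delta>(1) by (auto simp: CVaR_ball_def intro: le_less_trans)
      then obtain Q where "Q \<in> couplings (empirical N \<xi>s) P"
        "CVaR \<alpha> Q (\<lambda>(\<xi>1, \<xi>2). nrm (\<xi>1 - \<xi>2)) \<le> ereal (\<epsilon> + \<delta>)"
        unfolding d_CVaR_def INF_less_iff by (meson less_imp_le)
      then have "?E P \<le> ereal (max (A + Lip f * c * (1 - \<alpha>) * (\<epsilon> + \<delta>)) (B (\<epsilon> + \<delta>)))"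
        unfolding A_def B_def c_def using assms(3) \<delta>(1)
        by (intro coupling_upper_bound[OF nrm assms(2,4,5) _ conv lip]) auto
      also have "\<dots> \<le> ereal (max (A + Lip f * c * (1 - \<alpha>) * \<epsilon>) (B \<epsilon>) + e)"
      proof -
        have "Lip f * c * (1 - \<alpha>) * \<delta> \<le> Lip f * c * 1 * \<delta>"
          using L c assms(4) \<delta>(1) by (intro mult_right_mono mult_left_mono) auto
        then have "A + Lip f * c * (1 - \<alpha>) * (\<epsilon> + \<delta>) \<le> A + Lip f * c * (1 - \<alpha>) * \<epsilon> + e"
          using \<delta>(2) by (simp add: distrib_left)
        moreover have "B (\<epsilon> + \<delta>) \<le> B \<epsilon> + e"
        proof -
          have step: "f y \<le> f z + e" if "\<bar>y - z\<bar> = \<delta> * c" for y z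
          proof -
            have "f y - f z \<le> Lip f * (\<delta> * c)"
              using lipschitz_onD[OF lip, of y z] that by (simp add: dist_real_def)
            then show ?thesis using \<delta>(2) by (simp add: ac_simps)
          qed
          have "max (f (s - (\<epsilon> + \<delta>) * c)) (f (s + (\<epsilon> + \<delta>) * c)) \<le> max (f (s - \<epsilon> * c)) (f (s + \<epsilon> * c)) + e" for s
          proof -
            have "f (s - (\<epsilon> + \<delta>) * c) \<le> f (s - \<epsilon> * c) + e" "f (s + (\<epsilon> + \<delta>) * c) \<le> f (s + \<epsilon> * c) + e"
              using \<delta>(1) c by (auto intro!: step simp: distrib_right)
            then show ?thesis by linarith
          qed
          then have "B (\<epsilon> + \<delta>) \<le> (1 / real N) * (\<Sum>i=1..N. max (f (x \<bullet> \<xi>s i - \<epsilon> * c)) (f (x \<bullet> \<xi>s i + \<epsilon> * c)) + e)"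
            unfolding B_def by (intro mult_left_mono sum_mono) auto
          also have "\<dots> = B \<epsilon> + e"
            using assms(2) by (simp add: B_def sum.distrib field_simps)
          finally show ?thesis .
        qed
        ultimately show ?thesis
          unfolding ereal_less_eq(3) by linarith
      qed
      finally show "?E P \<le> max (ereal (A + Lip f * c * (1 - \<alpha>) * \<epsilon>)) (ereal (B \<epsilon>)) + ereal e"
        unfolding ereal_max[symmetric] plus_ereal.simps(1) .
    qed
  next
    obtain P where "P \<in> CVaR_ball nrm \<alpha> \<epsilon> (empirical N \<xi>s)" "?E P = ereal (B \<epsilon>)"
      unfolding B_def c_def by (rule CVaR_ball_translation[OF nrm assms(2,3,4,5) f])
    then have "ereal (B \<epsilon>) \<le> ?S"
      by (intro SUP_upper2) auto
    moreover have "ereal (A + Lip f * c * (1 - \<alpha>) * \<epsilon>) \<le> ?S"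
    proof (rule ereal_le_epsilon2)
      fix e :: real assume "0 < e"
      \<comment> \<open>Half of \<open>e\<close> pays for a slope smaller than \<open>Lip f\<close> by \<open>\<eta>\<close>, the other half for the mass
        \<open>p\<close> missing from the atoms.\<close>
      define k where "k = c * (1 - \<alpha>) * \<epsilon>"
      have "0 \<le> k"
        using c assms(3,5) by (simp add: k_def)
      define \<eta> where "\<eta> = e / 2 / (k + 1)"
      have \<eta>: "0 < \<eta>" "\<eta> * k \<le> e / 2"
        using \<open>0 < e\<close> \<open>0 \<le> k\<close> by (auto simp: \<eta>_def field_simps)
      obtain m q where line: "\<And>t. q + m * t \<le> f t" and m: "Lip f - \<eta> \<le> \<bar>m\<bar>"
        using supporting_line_near_Lip[OF conv \<eta>(1)] by blast
      define K where "K = (1 / real N) * (\<Sum>i=1..N. q + m * (x \<bullet> \<xi>s i)) - A"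
      define p where "p = min 1 (e / 2 / (\<bar>K\<bar> + 1))"
      have p: "0 < p" "p \<le> 1"
        using \<open>0 < e\<close> by (auto simp: p_def)
      have "p * \<bar>K\<bar> \<le> (e / 2 / (\<bar>K\<bar> + 1)) * (\<bar>K\<bar> + 1)"
        using \<open>0 < e\<close> p(1) by (intro mult_mono) (auto simp: p_def)
      also have "\<dots> = e / 2"
        by (rule nonzero_eq_divide_eq[THEN iffD1, OF _ refl]) linarith
      finally have "p * \<bar>K\<bar> \<le> e / 2" .
      moreover have "p * (- \<bar>K\<bar>) \<le> p * K"
        using p(1) by (intro mult_left_mono) auto
      ultimately have pK: "- (e / 2) \<le> p * K"
        by simp
      obtain P where P: "P \<in> CVaR_ball nrm \<alpha> \<epsilon> (empirical N \<xi>s)"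
        "ereal ((1 - p) * A + p * (K + A) + \<bar>m\<bar> * c * (1 - \<alpha>) * \<epsilon>) \<le> ?E P"
        unfolding A_def K_def c_def diff_add_cancel
        by (rule CVaR_ball_escaping_mass[OF nrm assms(2,3,4,5) f line p])
      have "(Lip f - \<eta>) * k \<le> \<bar>m\<bar> * k"
        using m \<open>0 \<le> k\<close> by (rule mult_right_mono)
      then have "A + Lip f * c * (1 - \<alpha>) * \<epsilon> \<le> (1 - p) * A + p * (K + A) + \<bar>m\<bar> * c * (1 - \<alpha>) * \<epsilon> + e"
        using pK \<eta>(2) unfolding k_def by (simp add: algebra_simps)
      then have "ereal (A + Lip f * c * (1 - \<alpha>) * \<epsilon>)
          \<le> ereal ((1 - p) * A + p * (K + A) + \<bar>m\<bar> * c * (1 - \<alpha>) * \<epsilon>) + ereal e"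
        by simp
      also have "\<dots> \<le> ?S + ereal e"
        using P by (intro add_right_mono) (rule SUP_upper2)
      finally show "ereal (A + Lip f * c * (1 - \<alpha>) * \<epsilon>) \<le> ?S + ereal e" .
    qed
    ultimately show "max (ereal (A + Lip f * c * (1 - \<alpha>) * \<epsilon>)) (ereal (B \<epsilon>)) \<le> ?S"
      by simp
  qed
  then show "?S = max (ereal ((1 / real N) * (\<Sum>i=1..N. f (x \<bullet> \<xi>s i)) + Lip f * dual_norm nrm x * (1 - \<alpha>) * \<epsilon>))
        (ereal (1 / real N) *
           (\<Sum>i=1..N. max (f1 f t0 (x \<bullet> \<xi>s i - \<epsilon> * dual_norm nrm x))
                          (f2 f t0 (x \<bullet> \<xi>s i + \<epsilon> * dual_norm nrm x))))"
    using rhs by (simp only: A_def c_def)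
qed

end
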